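(* Let $D$ be a non-empty set and $X$ a Banach space. If $V\subseteq F(D,X)$ is a BK-space that does not vanish at any point, then: i. $M(V)$, with pointwise product and the operator norm, is a commutative Banach algebra having the constant function $\mathit 1$ as identity, and $\|\mathit 1\|_{M(V)}=1$. ii. $M(V)\subseteq B(D,\mathbb K)$ and $\sup_{a\in D}|f(a)|\le\|f\|_{M(V)}$ for all $f\in M(V)$.
   Context: $\mathbb K=\mathbb R$ or $\mathbb C$. $F(D,X)$ is the vector space of all functions $D\to X$. A BK-space in $F(D,X)$ is a vector subspace with a complete norm for which every evaluation $v\mapsto v(a)$, $a\in D$, is continuous into $X$. $V$ does not vanish at any point if for every $a\in D$ there is $v\in V$ with $v(a)\ne0$. $M(V):=\{f\in F(D,\mathbb K): f\cdot v\in V\ \forall v\in V\}$, where $(f\cdot v)(a)=f(a)v(a)$, with operator norm $\|f\|_{M(V)}:=\sup\{\|f\cdot v\|_V:\|v\|_V\le1\}$. $B(D,\mathbb K)$ is the space of bounded functions $D\to\mathbb K$ with the supremum norm, and $\mathit 1(a)=1$ for all $a\in D$. *)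

theory Defs
  imports "HOL-Analysis.Analysis" "HOL-Library.Function_Algebras"
begin

text \<open>
  The scalar field is a type \<open>'k\<close> that is a copy of the reals or of the complex numbers: a normed
  field with a bijective, norm-preserving field isomorphism onto one of the two.
\<close>

class real_or_complex = real_normed_field +
  assumes ex_real_or_complex_iso:
    "(\<exists>\<phi>::'a \<Rightarrow> real. bij \<phi> \<and> (\<forall>x y. \<phi> (x + y) = \<phi> x + \<phi> y) \<and>
        (\<forall>x y. \<phi> (x * y) = \<phi> x * \<phi> y) \<and> (\<forall>x. norm (\<phi> x) = norm x)) \<or>
     (\<exists>\<phi>::'a \<Rightarrow> complex. bij \<phi> \<and> (\<forall>x y. \<phi> (x + y) = \<phi> x + \<phi> y) \<and>
        (\<forall>x y. \<phi> (x * y) = \<phi> x * \<phi> y) \<and> (\<forall>x. norm (\<phi> x) = norm x))"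

instance real :: real_or_complex
  by standard (rule disjI1, rule exI[of _ "\<lambda>x. x"], simp add: bij_def)

instance complex :: real_or_complex
  by standard (rule disjI2, rule exI[of _ "\<lambda>x. x"], simp add: bij_def)


subsection \<open>Normed spaces and Banach spaces on a carrier\<close>

text \<open>
  The norm is a total function; its values off the carrier are arbitrary, whereas
  \<^locale>\<open>Metric_space\<close> asks for nonnegativity and symmetry everywhere. Hence the cut-off.
\<close>

definition norm_dist :: "'v::ab_group_add set \<Rightarrow> ('v \<Rightarrow> real) \<Rightarrow> 'v \<Rightarrow> 'v \<Rightarrow> real" where
  "norm_dist V N u v = (if u \<in> V \<and> v \<in> V then N (u - v) else 0)"

locale normed_space_on = vector_space scale
  for scale :: "'k::real_or_complex \<Rightarrow> 'v::ab_group_add \<Rightarrow> 'v" +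
  fixes V :: "'v set" and N :: "'v \<Rightarrow> real"
  assumes subspace_carrier: "subspace V"
    and norm_definite: "\<And>v. v \<in> V \<Longrightarrow> N v = 0 \<longleftrightarrow> v = 0"
    and norm_scale: "\<And>c v. v \<in> V \<Longrightarrow> N (scale c v) = norm c * N v"
    and norm_triangle: "\<And>u v. u \<in> V \<Longrightarrow> v \<in> V \<Longrightarrow> N (u + v) \<le> N u + N v"
begin

lemma norm_neg: "v \<in> V \<Longrightarrow> N (- v) = N v"
  using norm_scale[of v "-1"] by simp

lemma norm_nonneg: "v \<in> V \<Longrightarrow> 0 \<le> N v"
  using norm_triangle[of v "- v"] norm_neg[of v] norm_definite[of 0]
    subspace_0[OF subspace_carrier] subspace_neg[OF subspace_carrier, of v] by simp

lemma Metric_space_norm_dist: "Metric_space V (norm_dist V N)"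
proof
  note diff = subspace_diff[OF subspace_carrier]
  show "0 \<le> norm_dist V N x y" for x y
    by (simp add: norm_dist_def norm_nonneg diff)
  show "norm_dist V N x y = norm_dist V N y x" for x y
    using norm_neg[of "x - y"] by (simp add: norm_dist_def diff)
  show "norm_dist V N x y = 0 \<longleftrightarrow> x = y" if "x \<in> V" "y \<in> V" for x y
    using that by (simp add: norm_dist_def diff norm_definite)
  show "norm_dist V N x z \<le> norm_dist V N x y + norm_dist V N y z"
    if "x \<in> V" "y \<in> V" "z \<in> V" for x y z
    using that norm_triangle[of "x - y" "y - z"] by (simp add: norm_dist_def diff)
qed

end

abbreviation norm_topology :: "'v::ab_group_add set \<Rightarrow> ('v \<Rightarrow> real) \<Rightarrow> 'v topology" where
  "norm_topology V N \<equiv> Metric_space.mtopology V (norm_dist V N)"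

locale banach_space_on = normed_space_on +
  assumes complete: "Metric_space.mcomplete V (norm_dist V N)"

locale unital_commutative_banach_algebra_on = banach_space_on scale A N
  for scale :: "'k::real_or_complex \<Rightarrow> 'v::ab_group_add \<Rightarrow> 'v" and A N +
  fixes mult :: "'v \<Rightarrow> 'v \<Rightarrow> 'v" and e :: 'v
  assumes mult_closed: "\<And>f g. f \<in> A \<Longrightarrow> g \<in> A \<Longrightarrow> mult f g \<in> A"
    and mult_assoc: "\<And>f g h. f \<in> A \<Longrightarrow> g \<in> A \<Longrightarrow> h \<in> A \<Longrightarrow>
          mult (mult f g) h = mult f (mult g h)"
    and mult_commute: "\<And>f g. f \<in> A \<Longrightarrow> g \<in> A \<Longrightarrow> mult f g = mult g f"
    and mult_add_left: "\<And>f g h. f \<in> A \<Longrightarrow> g \<in> A \<Longrightarrow> h \<in> A \<Longrightarrow>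
          mult (f + g) h = mult f h + mult g h"
    and mult_scale_left: "\<And>c f g. f \<in> A \<Longrightarrow> g \<in> A \<Longrightarrow>
          mult (scale c f) g = scale c (mult f g)"
    and norm_mult_le: "\<And>f g. f \<in> A \<Longrightarrow> g \<in> A \<Longrightarrow> N (mult f g) \<le> N f * N g"
    and unit_mem: "e \<in> A"
    and mult_unit: "\<And>f. f \<in> A \<Longrightarrow> mult e f = f"


subsection \<open>Function spaces\<close>

text \<open>
  The non-empty set \<open>D\<close> is a type \<open>'d\<close>; addition of functions is pointwise
  (\<^theory>\<open>HOL-Library.Function_Algebras\<close>). Scalar multiplication of a \<open>'k\<close>-space is an explicit
  argument \<open>smul\<close>; for functions with values in \<open>'k\<close> itself it is \<open>(*)\<close>.
\<close>

definition fun_mul :: "('k \<Rightarrow> 'x \<Rightarrow> 'x) \<Rightarrow> ('d \<Rightarrow> 'k) \<Rightarrow> ('d \<Rightarrow> 'x) \<Rightarrow> 'd \<Rightarrow> 'x" where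
  "fun_mul smul f v = (\<lambda>a. smul (f a) (v a))"

definition fun_scale :: "('k \<Rightarrow> 'x \<Rightarrow> 'x) \<Rightarrow> 'k \<Rightarrow> ('d \<Rightarrow> 'x) \<Rightarrow> 'd \<Rightarrow> 'x" where
  "fun_scale smul c v = (\<lambda>a. smul c (v a))"

locale BK_space = banach_space_on "fun_scale smul" V N
  for smul :: "'k::real_or_complex \<Rightarrow> 'x::ab_group_add \<Rightarrow> 'x"
    and normX :: "'x \<Rightarrow> real" and V :: "('d \<Rightarrow> 'x) set" and N :: "('d \<Rightarrow> 'x) \<Rightarrow> real" +
  assumes continuous_eval:
    "\<And>a. continuous_map (norm_topology V N) (norm_topology UNIV normX) (\<lambda>v. v a)"

definition nowhere_vanishing :: "('d \<Rightarrow> 'x::zero) set \<Rightarrow> bool" where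
  "nowhere_vanishing V \<longleftrightarrow> (\<forall>a. \<exists>v\<in>V. v a \<noteq> 0)"

definition multipliers :: "('k \<Rightarrow> 'x \<Rightarrow> 'x) \<Rightarrow> ('d \<Rightarrow> 'x) set \<Rightarrow> ('d \<Rightarrow> 'k) set" where
  "multipliers smul V = {f. \<forall>v\<in>V. fun_mul smul f v \<in> V}"

definition multiplier_values ::
  "('k \<Rightarrow> 'x \<Rightarrow> 'x) \<Rightarrow> ('d \<Rightarrow> 'x) set \<Rightarrow> (('d \<Rightarrow> 'x) \<Rightarrow> real) \<Rightarrow> ('d \<Rightarrow> 'k) \<Rightarrow> real set" where
  "multiplier_values smul V N f = {N (fun_mul smul f v) | v. v \<in> V \<and> N v \<le> 1}"

text \<open>The supremum is one of reals, meaningful only where \<^const>\<open>multiplier_values\<close> is bounded.\<close>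

definition multiplier_norm ::
  "('k \<Rightarrow> 'x \<Rightarrow> 'x) \<Rightarrow> ('d \<Rightarrow> 'x) set \<Rightarrow> (('d \<Rightarrow> 'x) \<Rightarrow> real) \<Rightarrow> ('d \<Rightarrow> 'k) \<Rightarrow> real" where
  "multiplier_norm smul V N f = Sup (multiplier_values smul V N f)"

definition bounded_functions :: "('d \<Rightarrow> 'k::real_normed_vector) set" where
  "bounded_functions = {f. bounded (range f)}"

end

theory Submission
  imports Defs
begin

text \<open>
  Multiplication by \<open>f \<in> M(V)\<close> has a closed graph because evaluations are continuous, so it is a
  bounded operator on \<open>V\<close>, and \<open>M(V)\<close> embeds into the bounded operators as a commutative normed
  algebra. For the bound \<open>|f a| \<le> \<parallel>f\<parallel>\<close>, apply powers of \<open>f / f a\<close> to some \<open>v \<in> V\<close> with \<open>v a \<noteq> 0\<close>. By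
  this bound a Cauchy sequence \<open>f\<^sub>n\<close> in \<open>M(V)\<close> converges pointwise, and its pointwise limit \<open>f\<close> is
  again a multiplier, since the limit of \<open>f\<^sub>n v\<close> in \<open>V\<close> can only be \<open>f v\<close>.
\<close>

section \<open>Convergence on a normed carrier\<close>

context normed_space_on
begin

text \<open>For a sequence inside \<open>V\<close> the cut-off in \<open>norm_dist\<close> never
  takes effect, so convergence in the topology can be traded for a real limit of norms, the form
  used in all later arguments.\<close>

lemma limitin_norm_topology_iff:
  assumes "\<And>n. s n \<in> V"
  shows "limitin (norm_topology V N) s l sequentially \<longleftrightarrow>
    l \<in> V \<and> (\<lambda>n. N (s n - l)) \<longlonglongrightarrow> 0"
proof -
  interpret Metric_space V "norm_dist V N" by (rule Metric_space_norm_dist)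
  show ?thesis
    using assms
    by (auto simp: limitin_metric tendsto_iff norm_dist_def norm_nonneg
        subspace_diff[OF subspace_carrier])
qed

lemma MCauchy_norm_dist_iff:
  "Metric_space.MCauchy V (norm_dist V N) s \<longleftrightarrow>
    (\<forall>n. s n \<in> V) \<and> (\<forall>\<epsilon>>0. \<exists>n0. \<forall>m\<ge>n0. \<forall>n\<ge>n0. N (s m - s n) < \<epsilon>)"
proof -
  interpret Metric_space V "norm_dist V N" by (rule Metric_space_norm_dist)
  show ?thesis
  proof (cases "\<forall>n. s n \<in> V")
    case True
    then show ?thesis by (auto simp: MCauchy_def norm_dist_def image_subset_iff)
  next
    case False
    then show ?thesis by (auto simp: MCauchy_def)
  qed
qed

lemma norm_triangle_diff: "u \<in> V \<Longrightarrow> v \<in> V \<Longrightarrow> N (u - v) \<le> N u + N v"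
  using norm_triangle[of u "- v"] norm_neg[of v] subspace_neg[OF subspace_carrier, of v] by simp

lemma norm_minus_commute: "u \<in> V \<Longrightarrow> v \<in> V \<Longrightarrow> N (u - v) = N (v - u)"
  using norm_neg[OF subspace_diff[OF subspace_carrier, of u v]] by simp

lemma norm_scale_of_real: "v \<in> V \<Longrightarrow> 0 \<le> c \<Longrightarrow> N (scale (of_real c) v) = c * N v"
  by (subst norm_scale) simp_all

lemma norm_limit_unique:
  assumes "\<And>n. s n \<in> V" "l \<in> V" "l' \<in> V"
    and "(\<lambda>n. N (s n - l)) \<longlonglongrightarrow> 0" "(\<lambda>n. N (s n - l')) \<longlonglongrightarrow> 0"
  shows "l = l'"
proof -
  interpret Metric_space V "norm_dist V N" by (rule Metric_space_norm_dist)
  show ?thesis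
    using assms limitin_metric_unique[of s l sequentially l']
    by (simp add: limitin_norm_topology_iff)
qed

end

lemma (in banach_space_on) norm_Cauchy_convergent:
  assumes "\<And>n. s n \<in> V"
    and "\<And>\<epsilon>. 0 < \<epsilon> \<Longrightarrow> \<exists>n0. \<forall>m\<ge>n0. \<forall>n\<ge>n0. N (s m - s n) < \<epsilon>"
  obtains l where "l \<in> V" "(\<lambda>n. N (s n - l)) \<longlonglongrightarrow> 0"
proof -
  interpret Metric_space V "norm_dist V N" by (rule Metric_space_norm_dist)
  have "MCauchy s" using assms by (simp add: MCauchy_norm_dist_iff)
  then obtain l where "limitin mtopology s l sequentially"
    using complete by (auto simp: mcomplete_def)
  then show ?thesis using assms(1) that by (auto simp: limitin_norm_topology_iff)
qed

text \<open>Completeness is pulled back from \<open>real\<close> or \<open>complex\<close>: an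
  additive bijection that preserves norms is an isometry in both directions.\<close>

lemma real_or_complex_Cauchy_convergent:
  fixes s :: "nat \<Rightarrow> 'k::real_or_complex"
  assumes "Cauchy s"
  shows "convergent s"
proof -
  have main: "convergent s"
    if "bij \<phi>" and add: "\<And>x y. \<phi> (x + y) = \<phi> x + \<phi> y" and nrm: "\<And>x. norm (\<phi> x) = norm x"
    for \<phi> :: "'k \<Rightarrow> 'b::banach"
  proof -
    have diff: "\<phi> (x - y) = \<phi> x - \<phi> y" for x y
      using add[of "x - y" y] by simp
    have "Cauchy (\<lambda>n. \<phi> (s n))"
      using assms by (simp add: Cauchy_def dist_norm nrm flip: diff)
    then obtain b where "(\<lambda>n. \<phi> (s n)) \<longlonglongrightarrow> b"
      using Cauchy_convergent convergent_def by blast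
    moreover obtain l where "b = \<phi> l" using \<open>bij \<phi>\<close> by (metis bij_pointE)
    ultimately have "s \<longlonglongrightarrow> l"
      by (simp add: tendsto_iff dist_norm nrm flip: diff)
    then show ?thesis by (auto simp: convergent_def)
  qed
  show ?thesis
    using ex_real_or_complex_iso[where ?'a = 'k] by (elim disjE exE) (auto intro: main)
qed

section \<open>The closed graph theorem\<close>

text \<open>For linear \<open>T\<close> the graph is closed as soon as it is closed at \<open>(0, w)\<close>, the form of the
  hypothesis used here.\<close>

lemma closed_graph_bounded:
  fixes s1 :: "'k::real_or_complex \<Rightarrow> 'v::ab_group_add \<Rightarrow> 'v"
    and s2 :: "'k \<Rightarrow> 'w::ab_group_add \<Rightarrow> 'w"
  assumes "banach_space_on s1 V N" and "banach_space_on s2 W M"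
    and T_mem: "\<And>v. v \<in> V \<Longrightarrow> T v \<in> W"
    and T_add: "\<And>u v. u \<in> V \<Longrightarrow> v \<in> V \<Longrightarrow> T (u + v) = T u + T v"
    and T_scale: "\<And>c v. v \<in> V \<Longrightarrow> T (s1 c v) = s2 c (T v)"
    and closed: "\<And>s w. (\<And>n. s n \<in> V) \<Longrightarrow> w \<in> W \<Longrightarrow> (\<lambda>n. N (s n)) \<longlonglongrightarrow> 0 \<Longrightarrow>
      (\<lambda>n. M (T (s n) - w)) \<longlonglongrightarrow> 0 \<Longrightarrow> w = 0"
  obtains C where "0 \<le> C" "\<And>v. v \<in> V \<Longrightarrow> M (T v) \<le> C * N v"
proof -
  interpret V: banach_space_on s1 V N by fact
  interpret W: banach_space_on s2 W M by fact
  interpret MV: Metric_space V "norm_dist V N" by (rule V.Metric_space_norm_dist)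
  note subV = V.subspace_carrier and subW = W.subspace_carrier
  note [simp] = V.subspace_0[OF subV] V.subspace_add[OF subV] V.subspace_diff[OF subV]
    V.subspace_scale[OF subV] V.subspace_neg[OF subV]
  note [simp] = W.subspace_0[OF subW] W.subspace_add[OF subW] W.subspace_diff[OF subW]
    W.subspace_scale[OF subW] T_mem
  have T_diff: "T (u - v) = T u - T v" if "u \<in> V" "v \<in> V" for u v
    using T_add[of "u - v" v] that by simp
  \<comment> \<open>These sublevel sets exhaust the complete space \<open>V\<close>, so by Baire the
    closure of one of them contains a ball, whose centre \<open>x\<close> is unknown.\<close>
  define E where "E n = {v \<in> V. M (T v) \<le> real n}" for n
  have "\<exists>n. MV.mtopology interior_of (MV.mtopology closure_of E n) \<noteq> {}"
  proof (rule ccontr)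
    assume "\<not> ?thesis"
    then have "MV.mtopology interior_of \<Union>(range (\<lambda>n. MV.mtopology closure_of E n)) = {}"
      by (intro MV.metric_Baire_category_alt V.complete) auto
    moreover have "\<Union>(range (\<lambda>n. MV.mtopology closure_of E n)) = V"
    proof
      have "v \<in> E (nat \<lceil>M (T v)\<rceil>)" if "v \<in> V" for v
        using that by (simp add: E_def real_nat_ceiling_ge)
      moreover have "E n \<subseteq> MV.mtopology closure_of E n" for n
        by (rule closure_of_subset) (auto simp: E_def)
      ultimately show "V \<subseteq> \<Union>(range (\<lambda>n. MV.mtopology closure_of E n))" by blast
      show "\<Union>(range (\<lambda>n. MV.mtopology closure_of E n)) \<subseteq> V"
        using closure_of_subset_topspace[of MV.mtopology] by auto
    qed
    ultimately show False
      using interior_of_topspace[of MV.mtopology] V.subspace_0[OF subV] by auto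
  qed
  then obtain n x r where "x \<in> V" and "0 < r"
    and ball: "MV.mball x r \<subseteq> MV.mtopology closure_of E n"
    by (auto simp: MV.metric_interior_of)
  have near: "\<exists>u\<in>V. M (T u) \<le> real n \<and> N (y - u) < e"
    if "y \<in> V" "N (y - x) < r" "0 < e" for y e
  proof -
    have "y \<in> MV.mball x r"
      using that \<open>x \<in> V\<close> V.norm_minus_commute[of y x] by (simp add: norm_dist_def)
    then have "y \<in> MV.mtopology closure_of E n" using ball by blast
    then obtain u where "u \<in> E n" "u \<in> MV.mball y e"
      unfolding MV.metric_closure_of using \<open>0 < e\<close> by blast
    then show ?thesis by (auto simp: E_def norm_dist_def)
  qed
  \<comment> \<open>The ball is moved from \<open>x\<close> to the origin. If \<open>u1\<close> and
    \<open>u2\<close> approximate \<open>x + z\<close> and \<open>x - z\<close>, then half of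
    \<open>u1 - u2\<close> approximates \<open>z\<close>, and averaging costs nothing in the bound
    \<open>n\<close>.\<close>
  have near0: "\<exists>u\<in>V. M (T u) \<le> real n \<and> N (z - u) < e"
    if z: "z \<in> V" "N z < r" "0 < e" for z e
  proof -
    obtain u1 where u1: "u1 \<in> V" "M (T u1) \<le> real n" "N ((x + z) - u1) < e"
      using near[of "x + z" e] z \<open>x \<in> V\<close> by auto
    obtain u2 where u2: "u2 \<in> V" "M (T u2) \<le> real n" "N ((x - z) - u2) < e"
      using near[of "x - z" e] z \<open>x \<in> V\<close> V.norm_neg[of z] by auto
    define h where "h = (of_real (1/2) :: 'k)"
    let ?u = "s1 h (u1 - u2)"
    have "M (T ?u) = 1/2 * M (T u1 - T u2)"
      using u1 u2 unfolding h_def by (subst T_scale, simp, subst W.norm_scale_of_real) (simp_all add: T_diff)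
    also have "\<dots> \<le> real n"
      using W.norm_triangle_diff[of "T u1" "T u2"] u1 u2 by simp
    finally have bd: "M (T ?u) \<le> real n" .
    have "s1 h (z + z) = s1 (h + h) z" by (simp only: V.scale_left_distrib V.scale_right_distrib)
    also have "h + h = 1" by (simp add: h_def flip: of_real_add)
    finally have zz: "s1 h (z + z) = z" by simp
    have "z - ?u = s1 h (z + z) - ?u" using zz by simp
    also have "\<dots> = s1 h (((x + z) - u1) - ((x - z) - u2))"
      unfolding V.scale_right_diff_distrib[symmetric] by (simp add: algebra_simps)
    finally have "N (z - ?u) = 1/2 * N (((x + z) - u1) - ((x - z) - u2))"
      using u1 u2 z \<open>x \<in> V\<close> unfolding h_def
      by (simp only:) (rule V.norm_scale_of_real, simp_all)
    also have "\<dots> < e"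
      using V.norm_triangle_diff[of "(x + z) - u1" "(x - z) - u2"] u1 u2 z \<open>x \<in> V\<close> by simp
    finally show ?thesis using bd u1 u2 by (intro bexI[of _ ?u]) auto
  qed
  define K where "K = 2 * real n / r"
  have K: "0 \<le> K" using \<open>0 < r\<close> by (simp add: K_def)
  have approx: "\<exists>u\<in>V. M (T u) \<le> K * t \<and> N (z - u) < e"
    if z: "z \<in> V" "N z \<le> t" and t: "0 < t" and e: "0 < e" for z t e
  proof -
    \<comment> \<open>Scaling by \<open>\<rho>\<close> brings \<open>z\<close> to norm at most
      \<open>r / 2\<close>, strictly inside the ball of \<open>near0\<close>. Scaling back turns the
      bound \<open>n\<close> into \<open>n / \<rho> = K * t\<close>.\<close>
    define \<rho> where "\<rho> = r / (2 * t)"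
    have \<rho>: "0 < \<rho>" using \<open>0 < r\<close> t by (simp add: \<rho>_def)
    note scl = V.norm_scale_of_real[of _ \<rho>] V.norm_scale_of_real[of _ "1/\<rho>"]
      W.norm_scale_of_real[of _ "1/\<rho>"]
    have "N (s1 (of_real \<rho>) z) \<le> \<rho> * t"
      using z \<rho> by (subst scl) simp_all
    also have "\<dots> < r" using \<open>0 < r\<close> t by (simp add: \<rho>_def)
    finally obtain u where u: "u \<in> V" "M (T u) \<le> real n" "N (s1 (of_real \<rho>) z - u) < \<rho> * e"
      using near0[of "s1 (of_real \<rho>) z" "\<rho> * e"] z \<rho> e by auto
    let ?u = "s1 (of_real (1/\<rho>)) u"
    have "M (T ?u) = 1/\<rho> * M (T u)"
      using u \<rho> by (subst T_scale, simp, subst scl(3)) simp_all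
    also have "\<dots> \<le> 1/\<rho> * real n"
      using u \<rho> by (intro mult_left_mono) auto
    also have "\<dots> = K * t" using \<open>0 < r\<close> t by (simp add: K_def \<rho>_def field_simps)
    finally have bd: "M (T ?u) \<le> K * t" .
    have "s1 (of_real (1/\<rho>)) (s1 (of_real \<rho>) z) = z"
      using \<rho> by (simp only: V.scale_scale flip: of_real_mult) simp
    then have "z - ?u = s1 (of_real (1/\<rho>)) (s1 (of_real \<rho>) z - u)"
      by (simp only: V.scale_right_diff_distrib)
    then have "N (z - ?u) = 1/\<rho> * N (s1 (of_real \<rho>) z - u)"
      using u z \<rho> by (simp only:) (rule scl(2), simp_all)
    also have "\<dots> < e" using u \<rho> by (simp add: field_simps)
    finally show ?thesis using bd u by (intro bexI[of _ ?u]) auto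
  qed
  have bound: "M (T v) \<le> 2 * K * N v" if "v \<in> V" "v \<noteq> 0" for v
  proof -
    define t where "t = N v"
    have t: "0 < t" using that V.norm_definite[of v] V.norm_nonneg[of v] by (simp add: t_def)
    \<comment> \<open>Successive approximation: \<open>z k\<close> is what remains of
      \<open>v\<close> after \<open>k\<close> corrections. Each correction
      \<open>z k - z (Suc k)\<close> comes from \<open>approx\<close> and halves the bound on the
      remainder. The clause for \<open>k = 0\<close> carries the starting value through the choice
      principle.\<close>
    have "\<exists>z. \<forall>k. ((z k \<in> V \<and> N (z k) \<le> t / 2^k) \<and> (k = 0 \<longrightarrow> z k = v)) \<and>
      M (T (z k - z (Suc k))) \<le> K * (t / 2^k)"
    proof (rule dependent_nat_choice)
      show "\<exists>z. (z \<in> V \<and> N z \<le> t / 2^0) \<and> ((0::nat) = 0 \<longrightarrow> z = v)"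
        using that by (auto simp: t_def)
      fix z k assume z: "(z \<in> V \<and> N z \<le> t / 2^k) \<and> (k = 0 \<longrightarrow> z = v)"
      then obtain u where "u \<in> V" "M (T u) \<le> K * (t / 2^k)" "N (z - u) < t / 2 ^ Suc k"
        using approx[of z "t / 2^k" "t / 2 ^ Suc k"] t by auto
      then show "\<exists>z'. ((z' \<in> V \<and> N z' \<le> t / 2 ^ Suc k) \<and> (Suc k = 0 \<longrightarrow> z' = v)) \<and>
          M (T (z - z')) \<le> K * (t / 2^k)"
        using z by (intro exI[of _ "z - u"]) auto
    qed
    then obtain z where z0: "z 0 = v" and z: "\<And>k. z k \<in> V" "\<And>k. N (z k) \<le> t / 2^k"
      and step: "\<And>k. M (T (z k - z (Suc k))) \<le> K * (t / 2^k)" by blast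
    \<comment> \<open>The exact geometric partial sum, rather than the bound
      \<open>2 * K * t / 2^k\<close> wanted later, is what makes the induction on \<open>j\<close>
      close.\<close>
    have tail: "M (T (z k) - T (z (k + j))) \<le> 2 * K * t * (1 / 2^k - 1 / 2^(k + j))" for k j
    proof (induction j)
      case 0
      then show ?case using W.norm_definite[of 0] by simp
    next
      case (Suc j)
      have "M (T (z k) - T (z (k + Suc j))) =
          M ((T (z k) - T (z (k + j))) + T (z (k + j) - z (Suc (k + j))))"
        using z by (simp add: T_diff)
      also have "\<dots> \<le> M (T (z k) - T (z (k + j))) + M (T (z (k + j) - z (Suc (k + j))))"
        using z by (intro W.norm_triangle) auto
      also have "\<dots> \<le> 2 * K * t * (1 / 2^k - 1 / 2^(k + j)) + K * (t / 2^(k + j))"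
        by (intro add_mono Suc step)
      also have "\<dots> = 2 * K * t * (1 / 2^k - 1 / 2^(k + Suc j))" by (simp add: algebra_simps)
      finally show ?case .
    qed
    have tail': "M (T (z k) - T (z m)) \<le> 2 * K * t / 2^k" if "k \<le> m" for k m
    proof -
      have "M (T (z k) - T (z m)) \<le> 2 * K * t * (1 / 2^k - 1 / 2^m)"
        using tail[of k "m - k"] that by simp
      also have "\<dots> \<le> 2 * K * t * (1 / 2^k)"
        using K t by (intro mult_left_mono) auto
      finally show ?thesis by simp
    qed
    have geom: "(\<lambda>k. c / 2^k) \<longlonglongrightarrow> 0" for c :: real
      using tendsto_mult_right_zero[OF LIMSEQ_realpow_zero[of "1/2"], of c]
      by (simp add: power_divide)
    have cauchy: "\<exists>k0. \<forall>m\<ge>k0. \<forall>k\<ge>k0. M (T (z m) - T (z k)) < \<epsilon>" if "0 < \<epsilon>" for \<epsilon>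
    proof -
      from order_tendstoD(2)[OF geom \<open>0 < \<epsilon>\<close>, of "2 * K * t"]
      obtain k0 where k0: "\<And>k. k \<ge> k0 \<Longrightarrow> 2 * K * t / 2^k < \<epsilon>"
        by (auto simp: eventually_sequentially)
      have lt: "M (T (z m) - T (z k)) < \<epsilon>" if "k0 \<le> m" "m \<le> k" for m k
        using tail'[of m k] k0[of m] that by simp
      have "M (T (z m) - T (z k)) < \<epsilon>" if "k0 \<le> m" "k0 \<le> k" for m k
        using that lt[of m k] lt[of k m] W.norm_minus_commute[of "T (z m)" "T (z k)"] z
        by (cases "m \<le> k") auto
      then show ?thesis by blast
    qed
    obtain w where w: "w \<in> W" "(\<lambda>k. M (T (z k) - w)) \<longlonglongrightarrow> 0"
      using W.norm_Cauchy_convergent[of "\<lambda>k. T (z k)", OF _ cauchy] z by auto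
    have "(\<lambda>k. N (z k)) \<longlonglongrightarrow> 0"
      by (rule tendsto_sandwich[OF _ _ tendsto_const geom[of t]]) (auto simp: z V.norm_nonneg)
    \<comment> \<open>Here the closed graph enters: the remainders tend to 0 while their images tend
      to \<open>w\<close>.\<close>
    then have "w = 0" using closed[OF z(1) w(1) _ w(2)] by simp
    \<comment> \<open>Since \<open>z 0 = v\<close>, the image of \<open>v\<close> is split into that
      of the remainder, which vanishes in the limit, and that of all corrections so far, controlled
      by the tail estimate from index 0.\<close>
    have "M (T v) \<le> M (T (z k)) + 2 * K * t" for k
      using W.norm_triangle[of "T (z k)" "T v - T (z k)"] tail'[of 0 k] z z0 that by simp
    moreover have "(\<lambda>k. M (T (z k)) + 2 * K * t) \<longlonglongrightarrow> 0 + 2 * K * t"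
      using w(2) \<open>w = 0\<close> by (intro tendsto_intros) auto
    ultimately have "M (T v) \<le> 0 + 2 * K * t"
      by (intro LIMSEQ_le_const) auto
    then show ?thesis by (simp add: t_def)
  qed
  have "M (T v) \<le> 2 * K * N v" if "v \<in> V" for v
  proof (cases "v = 0")
    case True
    have "T 0 = 0" using T_diff[of 0 0] by simp
    then show ?thesis using True V.norm_definite[of 0] W.norm_definite[of 0] by simp
  next
    case False
    then show ?thesis using bound that by blast
  qed
  with K show thesis by (intro that[of "2 * K"]) auto
qed

section \<open>The multiplier algebra\<close>

lemma vector_space_fun_scale_mult:
  "vector_space (fun_scale (*) :: 'k::real_or_complex \<Rightarrow> ('d \<Rightarrow> 'k) \<Rightarrow> 'd \<Rightarrow> 'k)"
  by standard (simp_all add: fun_scale_def fun_eq_iff algebra_simps)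

locale nowhere_vanishing_BK_space = BK_space smul normX V N + X: normed_space_on smul UNIV normX
  for smul :: "'k::real_or_complex \<Rightarrow> 'x::ab_group_add \<Rightarrow> 'x"
    and normX :: "'x \<Rightarrow> real" and V :: "('d \<Rightarrow> 'x) set" and N :: "('d \<Rightarrow> 'x) \<Rightarrow> real" +
  assumes nowhere_vanishing: "nowhere_vanishing V"
begin

abbreviation "mul \<equiv> fun_mul smul"
abbreviation "Mul \<equiv> multipliers smul V"
abbreviation "mnorm \<equiv> multiplier_norm smul V N"

lemmas V_simps [simp] = subspace_0[OF subspace_carrier] subspace_add[OF subspace_carrier]
  subspace_diff[OF subspace_carrier] subspace_scale[OF subspace_carrier]

lemma norm_zero [simp]: "N 0 = 0"
  using norm_definite[of 0] by simp

lemma mul_in [simp]: "f \<in> Mul \<Longrightarrow> v \<in> V \<Longrightarrow> mul f v \<in> V"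
  by (simp add: multipliers_def)

text \<open>Multiplication operators are linear and depend on their multiplier as a unital algebra
  homomorphism, so facts about \<open>Mul\<close> reduce to facts about operators on
  \<open>V\<close>.\<close>

lemma mul_simps:
  "mul f (u + v) = mul f u + mul f v"
  "mul f (fun_scale smul c v) = fun_scale smul c (mul f v)"
  "mul f 0 = 0"
  "mul (f + g) v = mul f v + mul g v"
  "mul (f - g) v = mul f v - mul g v"
  "mul (fun_scale (*) c f) v = fun_scale smul c (mul f v)"
  "mul (fun_mul (*) f g) v = mul f (mul g v)"
  "mul 0 v = 0"
  "mul (\<lambda>a. 1) v = v"
  by (simp_all add: fun_mul_def fun_scale_def fun_eq_iff X.scale_right_distrib
      X.scale_left_distrib X.scale_left_diff_distrib mult.commute)

text \<open>Sequential form of \<open>continuous_eval\<close>; it identifies limits taken in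
  \<open>V\<close> by their values at each point.\<close>

lemma eval_tendsto:
  assumes "\<And>n. s n \<in> V" "l \<in> V" "(\<lambda>n. N (s n - l)) \<longlonglongrightarrow> 0"
  shows "(\<lambda>n. normX (s n a - l a)) \<longlonglongrightarrow> 0"
  using continuous_map_limit[OF continuous_eval[of a], of s l sequentially] assms
  by (simp add: limitin_norm_topology_iff X.limitin_norm_topology_iff o_def)

lemma nonvanishing_obtain:
  obtains v where "v \<in> V" "v a \<noteq> 0"
  using nowhere_vanishing by (auto simp: nowhere_vanishing_def)

section \<open>Boundedness of multiplication operators and the operator norm\<close>

lemma multiplier_bounded:
  assumes "f \<in> Mul"
  obtains C where "0 \<le> C" "\<And>v. v \<in> V \<Longrightarrow> N (mul f v) \<le> C * N v"
proof (rule closed_graph_bounded[of "fun_scale smul" V N "fun_scale smul" V N "mul f"])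
  show "banach_space_on (fun_scale smul) V N" "banach_space_on (fun_scale smul) V N"
    by unfold_locales
  fix s w assume s: "\<And>n. s n \<in> V" "w \<in> V" "(\<lambda>n. N (s n)) \<longlonglongrightarrow> 0"
    and fs: "(\<lambda>n. N (mul f (s n) - w)) \<longlonglongrightarrow> 0"
  \<comment> \<open>The scalars \<open>f a\<close> are fixed, so \<open>f a\<close> times
    \<open>s n a\<close> tends to 0 along with \<open>s n a\<close>; by continuity of evaluation it
    also tends to \<open>w a\<close>.\<close>
  have "w a = 0" for a
  proof (rule X.norm_limit_unique)
    have "(\<lambda>n. normX (mul f (s n) a - w a)) \<longlonglongrightarrow> 0"
      using eval_tendsto[OF _ _ fs, of a] s assms by simp
    then show "(\<lambda>n. normX (smul (f a) (s n a) - w a)) \<longlonglongrightarrow> 0"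
      by (simp add: fun_mul_def)
    have "(\<lambda>n. norm (f a) * normX (s n a)) \<longlonglongrightarrow> 0"
      using eval_tendsto[of s 0 a] s by (intro tendsto_mult_right_zero) simp
    then show "(\<lambda>n. normX (smul (f a) (s n a) - 0)) \<longlonglongrightarrow> 0"
      by (simp add: X.norm_scale)
  qed auto
  then show "w = 0" by (simp add: fun_eq_iff)
next
  fix C assume "0 \<le> C" "\<And>v. v \<in> V \<Longrightarrow> N (mul f v) \<le> C * N v"
  then show thesis by (rule that)
qed (use assms in \<open>simp_all add: mul_simps\<close>)

text \<open>The constant supplied by the closed graph theorem bounds all values on the unit ball.
  This makes the real \<open>Sup\<close> in \<open>multiplier_norm\<close> an actual least upper
  bound.\<close>

lemma bdd_above_multiplier_values:
  assumes "f \<in> Mul"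
  shows "bdd_above (multiplier_values smul V N f)"
proof -
  obtain C where C: "0 \<le> C" "\<And>v. v \<in> V \<Longrightarrow> N (mul f v) \<le> C * N v"
    using multiplier_bounded[OF assms] by blast
  have "N (mul f v) \<le> C" if "v \<in> V" "N v \<le> 1" for v
    using C(2)[OF that(1)] mult_left_mono[OF that(2) C(1)] by simp
  then show ?thesis
    by (intro bdd_aboveI[of _ C]) (auto simp: multiplier_values_def)
qed

lemma mnorm_nonneg:
  assumes "f \<in> Mul"
  shows "0 \<le> mnorm f"
proof -
  have "N (mul f 0) \<in> multiplier_values smul V N f"
    unfolding multiplier_values_def using V_simps(1) norm_zero by fastforce
  then show ?thesis
    unfolding multiplier_norm_def using bdd_above_multiplier_values[OF assms]
    by (simp add: mul_simps cSup_upper)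
qed

text \<open>For \<open>v \<noteq> 0\<close>, normalising \<open>v\<close> to norm 1 gives a member
  of the set whose supremum is taken.\<close>

lemma norm_mul_le:
  assumes "f \<in> Mul" "v \<in> V"
  shows "N (mul f v) \<le> mnorm f * N v"
proof (cases "v = 0")
  case True
  then show ?thesis by (simp add: mul_simps)
next
  case False
  then have pos: "0 < N v" using assms norm_definite[of v] norm_nonneg[of v] by simp
  let ?u = "fun_scale smul (of_real (1 / N v)) v"
  have "N ?u = 1" using pos assms by (subst norm_scale_of_real) auto
  moreover have "?u \<in> V" using assms by simp
  ultimately have "N (mul f ?u) \<le> mnorm f"
    unfolding multiplier_norm_def
    by (intro cSup_upper bdd_above_multiplier_values assms) (auto simp: multiplier_values_def)
  also have "N (mul f ?u) = 1 / N v * N (mul f v)"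
    using pos assms by (simp only: mul_simps, subst norm_scale_of_real) simp_all
  finally show ?thesis using pos by (simp add: field_simps)
qed

text \<open>Counterpart of \<open>norm_mul_le\<close>: together they reduce every estimate of
  \<open>mnorm\<close> to one on the vectors of \<open>V\<close>.\<close>

lemma mnorm_least:
  assumes "0 \<le> C" "\<And>v. v \<in> V \<Longrightarrow> N (mul f v) \<le> C * N v"
  shows "mnorm f \<le> C"
  unfolding multiplier_norm_def
proof (rule cSup_least)
  show "multiplier_values smul V N f \<noteq> {}"
    by (auto simp: multiplier_values_def intro: exI[of _ 0])
  fix r assume "r \<in> multiplier_values smul V N f"
  then obtain v where "r = N (mul f v)" "v \<in> V" "N v \<le> 1"
    by (auto simp: multiplier_values_def)
  then show "r \<le> C"
    using assms(2)[of v] mult_left_mono[of "N v" 1 C] assms(1) by simp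
qed

section \<open>Normed algebra structure of the multipliers and the pointwise bound\<close>

lemma Mul_intros:
  "0 \<in> Mul" "(\<lambda>a. 1) \<in> Mul"
  "f \<in> Mul \<Longrightarrow> g \<in> Mul \<Longrightarrow> f + g \<in> Mul"
  "f \<in> Mul \<Longrightarrow> g \<in> Mul \<Longrightarrow> f - g \<in> Mul"
  "f \<in> Mul \<Longrightarrow> fun_scale (*) c f \<in> Mul"
  "f \<in> Mul \<Longrightarrow> g \<in> Mul \<Longrightarrow> fun_mul (*) f g \<in> Mul"
  by (simp_all add: multipliers_def mul_simps del: mul_in)

lemma mnorm_scale_le: "f \<in> Mul \<Longrightarrow> mnorm (fun_scale (*) c f) \<le> norm c * mnorm f"
  using norm_mul_le mnorm_nonneg
  by (intro mnorm_least) (simp_all add: mul_simps norm_scale mult.assoc mult_left_mono)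

text \<open>For \<open>c \<noteq> 0\<close> the reverse inequality is \<open>mnorm_scale_le\<close>
  applied to \<open>inverse c\<close> and the scaled function.\<close>

lemma mnorm_scale:
  assumes "f \<in> Mul"
  shows "mnorm (fun_scale (*) c f) = norm c * mnorm f"
proof (cases "c = 0")
  case True
  then show ?thesis
    using mnorm_scale_le[OF assms, of c] mnorm_nonneg[OF Mul_intros(5)[OF assms], of c] by simp
next
  case False
  then have "fun_scale (*) (inverse c) (fun_scale (*) c f) = f"
    by (simp add: fun_scale_def fun_eq_iff)
  then have "mnorm f \<le> norm (inverse c) * mnorm (fun_scale (*) c f)"
    using mnorm_scale_le[OF Mul_intros(5)[OF assms], of "inverse c" c] by simp
  then have "norm c * mnorm f \<le> mnorm (fun_scale (*) c f)"
    using False by (simp add: norm_divide field_simps)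
  then show ?thesis using mnorm_scale_le[OF assms, of c] by simp
qed

text \<open>Definiteness rests on \<open>V\<close> being nowhere vanishing: a multiplier that
  annihilates \<open>V\<close> must be 0 at each \<open>a\<close>, since some \<open>v\<close> in
  \<open>V\<close> has \<open>v a \<noteq> 0\<close>.\<close>

lemma mnorm_eq_0_iff:
  assumes "f \<in> Mul"
  shows "mnorm f = 0 \<longleftrightarrow> f = 0"
proof
  assume "mnorm f = 0"
  have "f a = 0" for a
  proof -
    obtain v where v: "v \<in> V" "v a \<noteq> 0" by (rule nonvanishing_obtain)
    have "N (mul f v) \<le> 0"
      using norm_mul_le[OF assms v(1)] \<open>mnorm f = 0\<close> by simp
    then have "mul f v = 0"
      using assms v norm_nonneg[of "mul f v"] norm_definite[of "mul f v"] by simp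
    then have "mul f v a = 0" by simp
    then show "f a = 0" using v by (simp add: fun_mul_def)
  qed
  then show "f = 0" by (simp add: fun_eq_iff)
next
  assume "f = 0"
  then show "mnorm f = 0"
    using mnorm_least[of 0 f] mnorm_nonneg[OF assms] by (simp add: mul_simps)
qed

lemma normed_space_multipliers: "normed_space_on (fun_scale (*)) Mul mnorm"
proof -
  interpret F: vector_space "fun_scale (*) :: 'k \<Rightarrow> ('d \<Rightarrow> 'k) \<Rightarrow> 'd \<Rightarrow> 'k"
    by (rule vector_space_fun_scale_mult)
  show ?thesis
  proof
    show "F.subspace Mul" by (rule F.subspaceI) (auto intro: Mul_intros)
    fix f g assume fg: "f \<in> Mul" "g \<in> Mul"
    show "mnorm (f + g) \<le> mnorm f + mnorm g"
    proof (rule mnorm_least)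
      fix v assume v: "v \<in> V"
      have "N (mul (f + g) v) \<le> N (mul f v) + N (mul g v)"
        using fg v by (simp add: mul_simps norm_triangle)
      also have "\<dots> \<le> mnorm f * N v + mnorm g * N v"
        using fg v by (intro add_mono norm_mul_le)
      finally show "N (mul (f + g) v) \<le> (mnorm f + mnorm g) * N v" by (simp add: distrib_right)
    qed (use fg mnorm_nonneg in simp)
  qed (auto simp: mnorm_eq_0_iff mnorm_scale)
qed

sublocale M: normed_space_on "fun_scale (*)" Mul mnorm
  by (rule normed_space_multipliers)

lemma mnorm_mult_le:
  assumes "f \<in> Mul" "g \<in> Mul"
  shows "mnorm (fun_mul (*) f g) \<le> mnorm f * mnorm g"
proof (rule mnorm_least)
  fix v assume v: "v \<in> V"
  have "N (mul f (mul g v)) \<le> mnorm f * N (mul g v)"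
    using assms v by (simp add: norm_mul_le)
  also have "\<dots> \<le> mnorm f * (mnorm g * N v)"
    using assms v by (intro mult_left_mono norm_mul_le mnorm_nonneg)
  finally show "N (mul (fun_mul (*) f g) v) \<le> mnorm f * mnorm g * N v"
    by (simp add: mul_simps mult.assoc)
qed (use assms mnorm_nonneg in simp)

lemma mnorm_one: "mnorm (\<lambda>a. 1) = 1"
proof (rule antisym)
  show "mnorm (\<lambda>a. 1) \<le> 1" by (rule mnorm_least) (auto simp: mul_simps)
  \<comment> \<open>The point \<open>undefined\<close> is an arbitrary element of the non-empty
    domain; it yields a nonzero vector of \<open>V\<close>, which the unit multiplier fixes.\<close>
  obtain v where v: "v \<in> V" "v undefined \<noteq> 0" by (rule nonvanishing_obtain)
  then have "0 < N v" using norm_definite[of v] norm_nonneg[of v] by auto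
  then show "1 \<le> mnorm (\<lambda>a. 1)"
    using norm_mul_le[OF Mul_intros(2) v(1)] by (simp add: mul_simps)
qed

text \<open>If \<open>|f a|\<close> exceeded the norm of \<open>f\<close>, then \<open>g = f / f a\<close> would have norm below 1 and
  \<open>g\<^sup>n v\<close> would tend to 0 in \<open>V\<close>, although its value at \<open>a\<close> is always \<open>v a\<close>.\<close>

lemma norm_le_mnorm:
  assumes "f \<in> Mul"
  shows "norm (f a) \<le> mnorm f"
proof (rule ccontr)
  assume "\<not> ?thesis"
  then have less: "mnorm f < norm (f a)" by simp
  then have fa: "f a \<noteq> 0" using mnorm_nonneg[OF assms] by auto
  define g where "g = fun_scale (*) (inverse (f a)) f"
  have g: "g \<in> Mul" "g a = 1"
    using assms fa by (auto simp: g_def fun_scale_def intro: Mul_intros(5)[unfolded fun_scale_def])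
  have q: "mnorm g < 1"
    using less fa by (simp add: g_def mnorm_scale[OF assms] norm_divide field_simps)
  obtain v where v: "v \<in> V" "v a \<noteq> 0" by (rule nonvanishing_obtain)
  \<comment> \<open>Iterating the operator plays the role of multiplying by \<open>g ^ n\<close>, so
    \<open>norm_mul_le\<close> alone gives geometric decay.\<close>
  define p where "p n = (mul g ^^ n) v" for n
  have p_Suc: "p (Suc n) = mul g (p n)" for n by (simp add: p_def)
  have p: "p n \<in> V \<and> p n a = v a \<and> N (p n) \<le> mnorm g ^ n * N v" for n
  proof (induction n)
    case (Suc n)
    then have "N (p (Suc n)) \<le> mnorm g * (mnorm g ^ n * N v)"
      using norm_mul_le[OF g(1), of "p n"] mult_left_mono[OF _ mnorm_nonneg[OF g(1)]]
      by (force simp: p_Suc intro: order_trans)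
    moreover have "p (Suc n) a = p n a" by (simp add: p_Suc fun_mul_def g)
    ultimately show ?case using Suc g by (simp add: p_Suc mult.assoc)
  qed (use v in \<open>simp add: p_def\<close>)
  have "(\<lambda>n. mnorm g ^ n * N v) \<longlonglongrightarrow> 0"
    using q mnorm_nonneg[OF g(1)] by (intro tendsto_mult_left_zero LIMSEQ_realpow_zero)
  then have "(\<lambda>n. N (p n)) \<longlonglongrightarrow> 0"
    by (rule tendsto_sandwich[rotated 2, OF tendsto_const]) (auto simp: p norm_nonneg)
  then have "(\<lambda>n. normX (p n a)) \<longlonglongrightarrow> 0"
    using eval_tendsto[of p 0 a] p by simp
  then have "normX (v a) = 0" by (simp add: p LIMSEQ_const_iff)
  with v X.norm_definite[of "v a"] show False by simp
qed

lemma multipliers_bounded: "Mul \<subseteq> bounded_functions"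
  using norm_le_mnorm by (auto simp: bounded_functions_def bounded_iff)

section \<open>Completeness of the multiplier algebra\<close>

lemma Cauchy_multipliers_convergent:
  assumes mem: "\<And>n. F n \<in> Mul"
    and Cau: "\<And>\<epsilon>. 0 < \<epsilon> \<Longrightarrow> \<exists>n0. \<forall>m\<ge>n0. \<forall>n\<ge>n0. mnorm (F m - F n) < \<epsilon>"
  obtains f where "f \<in> Mul" "(\<lambda>n. mnorm (F n - f)) \<longlonglongrightarrow> 0"
proof -
  have "Cauchy (\<lambda>n. F n a)" for a
    unfolding Cauchy_def
  proof (intro allI impI)
    fix \<epsilon> :: real assume "0 < \<epsilon>"
    from Cau[OF this] obtain n0 where "\<And>m n. m \<ge> n0 \<Longrightarrow> n \<ge> n0 \<Longrightarrow> mnorm (F m - F n) < \<epsilon>" by blast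
    then show "\<exists>n0. \<forall>m\<ge>n0. \<forall>n\<ge>n0. dist (F m a) (F n a) < \<epsilon>"
      using norm_le_mnorm[OF Mul_intros(4)[OF mem mem], of _ _ a]
      by (simp add: dist_norm) (meson le_less_trans)
  qed
  then have "\<forall>a. \<exists>l. (\<lambda>n. F n a) \<longlonglongrightarrow> l"
    using real_or_complex_Cauchy_convergent by (auto simp: convergent_def)
  then obtain f where f: "\<And>a. (\<lambda>n. F n a) \<longlonglongrightarrow> f a" by metis
  have diff_le: "N (mul (F m) v - mul (F n) v) \<le> mnorm (F m - F n) * N v" if "v \<in> V" for m n v
    using norm_mul_le[OF Mul_intros(4)[OF mem mem] that, of m n] by (simp add: mul_simps)
  have lim: "mul f v \<in> V \<and> (\<lambda>n. N (mul (F n) v - mul f v)) \<longlonglongrightarrow> 0" if v: "v \<in> V" for v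
  proof -
    have Cau_v: "\<exists>n0. \<forall>m\<ge>n0. \<forall>n\<ge>n0. N (mul (F m) v - mul (F n) v) < \<epsilon>" if "0 < \<epsilon>" for \<epsilon>
    proof -
      \<comment> \<open>Adding 1 keeps the divisor positive even for \<open>v = 0\<close>.\<close>
      have pos: "0 < N v + 1" using norm_nonneg[OF v] by simp
      obtain n0 where n0: "\<And>m n. m \<ge> n0 \<Longrightarrow> n \<ge> n0 \<Longrightarrow> mnorm (F m - F n) < \<epsilon> / (N v + 1)"
        using Cau[OF divide_pos_pos[OF \<open>0 < \<epsilon>\<close> pos]] by blast
      have "N (mul (F m) v - mul (F n) v) < \<epsilon>" if "m \<ge> n0" "n \<ge> n0" for m n
      proof -
        have "N (mul (F m) v - mul (F n) v) \<le> mnorm (F m - F n) * (N v + 1)"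
          using diff_le[OF v, of m n] mnorm_nonneg[OF Mul_intros(4)[OF mem mem], of m n]
          by (simp add: distrib_left)
        also have "\<dots> < \<epsilon>" using n0[OF that] pos by (simp add: field_simps)
        finally show ?thesis .
      qed
      then show ?thesis by blast
    qed
    obtain w where w: "w \<in> V" "(\<lambda>n. N (mul (F n) v - w)) \<longlonglongrightarrow> 0"
      using norm_Cauchy_convergent[OF mul_in[OF mem v] Cau_v] by blast
    \<comment> \<open>Both sides are limits in \<open>X\<close> of the values of
      \<open>mul (F n) v\<close> at \<open>a\<close>: one by continuity of evaluation, the other by
      convergence of the scalars \<open>F n a\<close>.\<close>
    have "w a = mul f v a" for a
    proof (rule X.norm_limit_unique)
      show "(\<lambda>n. normX (mul (F n) v a - w a)) \<longlonglongrightarrow> 0"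
        using eval_tendsto[OF _ w] mem v by simp
      have "(\<lambda>n. norm (F n a - f a) * normX (v a)) \<longlonglongrightarrow> 0"
        using f[of a] by (intro tendsto_mult_left_zero tendsto_norm_zero) (simp add: LIM_zero)
      then show "(\<lambda>n. normX (mul (F n) v a - mul f v a)) \<longlonglongrightarrow> 0"
        by (simp add: fun_mul_def X.norm_scale flip: X.scale_left_diff_distrib)
    qed auto
    then have "mul f v = w" by (simp add: fun_eq_iff)
    with w show ?thesis by simp
  qed
  then have fM: "f \<in> Mul" by (simp add: multipliers_def del: mul_in)
  \<comment> \<open>Only a weak inequality survives the passage to the limit in \<open>m\<close>;
    strictness is regained at the end by using \<open>\<epsilon> / 2\<close>.\<close>
  have small: "\<exists>n0. \<forall>n\<ge>n0. mnorm (F n - f) \<le> \<epsilon>" if "0 < \<epsilon>" for \<epsilon>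
  proof -
    obtain n0 where n0: "\<And>m n. m \<ge> n0 \<Longrightarrow> n \<ge> n0 \<Longrightarrow> mnorm (F m - F n) < \<epsilon>"
      using Cau[OF \<open>0 < \<epsilon>\<close>] by blast
    have "mnorm (F n - f) \<le> \<epsilon>" if n: "n \<ge> n0" for n
    proof (rule mnorm_least)
      fix v assume v: "v \<in> V"
      \<comment> \<open>Here \<open>n\<close> stays fixed while \<open>m\<close> tends to infinity.
        As \<open>n0\<close> does not depend on \<open>v\<close>, the resulting estimate is a bound
        on the operator norm.\<close>
      have "N (mul (F n - f) v) \<le> \<epsilon> * N v + N (mul (F m) v - mul f v)" if "m \<ge> n0" for m
      proof -
        have "N (mul (F n - f) v) = N ((mul (F n) v - mul (F m) v) + (mul (F m) v - mul f v))"
          by (simp add: mul_simps)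
        also have "\<dots> \<le> N (mul (F n) v - mul (F m) v) + N (mul (F m) v - mul f v)"
          using mem fM v by (intro norm_triangle) simp_all
        also have "\<dots> \<le> \<epsilon> * N v + N (mul (F m) v - mul f v)"
          using diff_le[OF v, of n m] mult_right_mono[OF less_imp_le[OF n0[OF n that]] norm_nonneg[OF v]]
          by (intro add_right_mono) (rule order_trans)
        finally show ?thesis .
      qed
      moreover have "(\<lambda>m. \<epsilon> * N v + N (mul (F m) v - mul f v)) \<longlonglongrightarrow> \<epsilon> * N v + 0"
        using lim[OF v] by (intro tendsto_intros) simp
      ultimately show "N (mul (F n - f) v) \<le> \<epsilon> * N v"
        using LIMSEQ_le_const[of _ "\<epsilon> * N v + 0" "N (mul (F n - f) v)"] by auto
    qed (use \<open>0 < \<epsilon>\<close> in simp)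
    then show ?thesis by blast
  qed
  have "(\<lambda>n. mnorm (F n - f)) \<longlonglongrightarrow> 0"
  proof (rule LIMSEQ_I)
    fix \<epsilon> :: real assume "0 < \<epsilon>"
    then obtain n0 where "\<And>n. n \<ge> n0 \<Longrightarrow> mnorm (F n - f) \<le> \<epsilon> / 2"
      using small[of "\<epsilon> / 2"] by auto
    then show "\<exists>n0. \<forall>n\<ge>n0. norm (mnorm (F n - f) - 0) < \<epsilon>"
      using \<open>0 < \<epsilon>\<close> mnorm_nonneg[OF Mul_intros(4)[OF mem fM]]
      by (intro exI[of _ n0]) (fastforce intro: le_less_trans[of _ "\<epsilon> / 2"])
  qed
  with fM show thesis by (rule that)
qed

lemma banach_algebra_multipliers:
  "unital_commutative_banach_algebra_on (fun_scale (*)) Mul mnorm (fun_mul (*)) (\<lambda>a. 1)"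
proof
  interpret MM: Metric_space Mul "norm_dist Mul mnorm" by (rule M.Metric_space_norm_dist)
  show "MM.mcomplete"
    unfolding MM.mcomplete_def
  proof (intro allI impI)
    fix F assume "MM.MCauchy F"
    then have F: "\<And>n. F n \<in> Mul"
      "\<And>\<epsilon>. 0 < \<epsilon> \<Longrightarrow> \<exists>n0. \<forall>m\<ge>n0. \<forall>n\<ge>n0. mnorm (F m - F n) < \<epsilon>"
      by (auto simp: M.MCauchy_norm_dist_iff)
    then obtain f where "f \<in> Mul" "(\<lambda>n. mnorm (F n - f)) \<longlonglongrightarrow> 0"
      by (rule Cauchy_multipliers_convergent)
    then show "\<exists>f. limitin MM.mtopology F f sequentially"
      using F(1) by (auto simp: M.limitin_norm_topology_iff)
  qed
qed (auto simp: Mul_intros mnorm_mult_le, auto simp: fun_mul_def fun_scale_def fun_eq_iff algebra_simps)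

end

text \<open>The first conjunct certifies that the suprema defining \<open>multiplier_norm\<close>
  are genuine, and the inclusion in \<open>bounded_functions\<close> does the same for the supremum
  norm in the last conjunct.\<close>

theorem theorem5p2:
  fixes smul :: "'k::real_or_complex \<Rightarrow> 'x::ab_group_add \<Rightarrow> 'x"
    and normX :: "'x \<Rightarrow> real"
    and V :: "('d \<Rightarrow> 'x) set"
    and normV :: "('d \<Rightarrow> 'x) \<Rightarrow> real"
  assumes "banach_space_on smul UNIV normX"
    and "BK_space smul normX V normV"
    and "nowhere_vanishing V"
  shows "(\<forall>f \<in> multipliers smul V. bdd_above (multiplier_values smul V normV f)) \<and>
    unital_commutative_banach_algebra_on (fun_scale (*)) (multipliers smul V)
      (multiplier_norm smul V normV) (fun_mul (*)) (\<lambda>a. 1) \<and>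
    multiplier_norm smul V normV (\<lambda>a. 1) = 1 \<and>
    multipliers smul V \<subseteq> bounded_functions \<and>
    (\<forall>f \<in> multipliers smul V. (SUP a. norm (f a)) \<le> multiplier_norm smul V normV f)"
proof -
  interpret nowhere_vanishing_BK_space smul normX V normV
    using assms by (simp add: nowhere_vanishing_BK_space_def nowhere_vanishing_BK_space_axioms_def
        banach_space_on_def)
  show ?thesis
    using bdd_above_multiplier_values banach_algebra_multipliers mnorm_one multipliers_bounded
    by (auto intro!: cSUP_least norm_le_mnorm)
qed

end
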